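(* Let $\mathcal H$ be an infinite-dimensional complex Hilbert space. Then the generalized effect algebra $(\mathcal V_f(\mathcal H);\overline\oplus,o)$ is not monotone Dedekind downwards $\sigma$-complete.
   Context: Bilinear forms $t$ on $\mathcal H$ are sesquilinear maps $D(t)\times D(t)\to\mathbb C$ on a dense linear subspace $D(t)$ (linear in the first argument); $t$ is positive if $t(x,x)\ge0$ on $D(t)$, bounded if $\sup\{t(x,x)\mid x\in D(t),\|x\|=1\}<\infty$. The sum $t+s$ has domain $D(t)\cap D(s)$. $o$ is the zero form on $\mathcal H$. $\mathcal V_f(\mathcal H)$ is the set of positive bilinear forms with dense domain such that $D(t)=\mathcal H$ whenever $t$ is bounded; $t\oplus s$ is defined iff $t$ or $s$ is bounded or $D(t)=D(s)$, and then $t\oplus s=t+s$. A positive form is closed if $D(t)$ is a Hilbert space under $(x,y)_t=t(x,y)+(1+m_t)(x,y)$, $m_t=\inf\{t(x,x)\mid x\in D(t),\|x\|=1\}$; closable if it has a closed extension. For positive $t$, the regular part $t_r$ is the largest closable positive form with domain $D(t)$ and $t_r(x,x)\le t(x,x)$ on $D(t)$. $t\,\overline\oplus\,s$ is defined iff $t\oplus s$ is defined and $(t+s)_r=t_r+s_r$, and then equals $t+s$; $(\mathcal V_f(\mathcal H);\overline\oplus,o)$ is a generalized effect algebra with induced order $t\le s$ iff $t\,\overline\oplus\,r=s$ for some $r$. A generalized effect algebra is monotone Dedekind downwards $\sigma$-complete if every decreasing sequence in its induced order has an infimum in it. *)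

theory Defs
  imports "HOL-Analysis.Analysis"
begin

class chilbert = banach +
  fixes scaleC :: "complex \<Rightarrow> 'a \<Rightarrow> 'a" (infixr "*\<^sub>C" 75)
  fixes cinner :: "'a \<Rightarrow> 'a \<Rightarrow> complex"
  assumes scaleC_add_right: "a *\<^sub>C (x + y) = a *\<^sub>C x + a *\<^sub>C y"
  and scaleC_add_left: "(a + b) *\<^sub>C x = a *\<^sub>C x + b *\<^sub>C x"
  and scaleC_scaleC: "a *\<^sub>C (b *\<^sub>C x) = (a * b) *\<^sub>C x"
  and scaleC_one: "1 *\<^sub>C x = x"
  and scaleR_scaleC: "scaleR r x = complex_of_real r *\<^sub>C x"
  and cinner_commute: "cinner x y = cnj (cinner y x)"
  and cinner_add_left: "cinner (x + y) z = cinner x z + cinner y z"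
  and cinner_scaleC_left: "cinner (a *\<^sub>C x) y = a * cinner x y"
  and cinner_ge_zero: "0 \<le> Re (cinner x x)"
  and norm_eq_sqrt_cinner: "norm x = sqrt (Re (cinner x x))"

definition finite_dimensional_H :: "'a::chilbert itself \<Rightarrow> bool" where
  "finite_dimensional_H _ \<longleftrightarrow>
     (\<exists>B::'a set. finite B \<and> (\<forall>x. \<exists>c. x = (\<Sum>b\<in>B. c b *\<^sub>C b)))"

text \<open>A form is a pair (domain, values). Convention: the value function is 0
outside domain \<times> domain, so that HOL equality of pairs is equality of forms.\<close>

type_synonym 'a form = "'a set \<times> ('a \<Rightarrow> 'a \<Rightarrow> complex)"

definition csubspace :: "'a::chilbert set \<Rightarrow> bool" where
  "csubspace D \<longleftrightarrow> 0 \<in> D \<and> (\<forall>x\<in>D. \<forall>y\<in>D. x + y \<in> D) \<and> (\<forall>c. \<forall>x\<in>D. c *\<^sub>C x \<in> D)"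

definition is_form :: "'a::chilbert form \<Rightarrow> bool" where
  "is_form t \<longleftrightarrow> csubspace (fst t) \<and> closure (fst t) = UNIV \<and>
     (\<forall>x\<in>fst t. \<forall>y\<in>fst t. \<forall>z\<in>fst t. \<forall>c.
        snd t (x + y) z = snd t x z + snd t y z \<and>
        snd t x (y + z) = snd t x y + snd t x z \<and>
        snd t (c *\<^sub>C x) y = c * snd t x y \<and>
        snd t x (c *\<^sub>C y) = cnj c * snd t x y) \<and>
     (\<forall>x y. x \<notin> fst t \<or> y \<notin> fst t \<longrightarrow> snd t x y = 0)"

definition positive_form :: "'a::chilbert form \<Rightarrow> bool" where
  "positive_form t \<longleftrightarrow> is_form t \<and> (\<forall>x\<in>fst t. snd t x x \<in> \<real> \<and> 0 \<le> Re (snd t x x))"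

definition bounded_form :: "'a::chilbert form \<Rightarrow> bool" where
  "bounded_form t \<longleftrightarrow> bdd_above {Re (snd t x x) | x. x \<in> fst t \<and> norm x = 1}"

definition form_add :: "'a::chilbert form \<Rightarrow> 'a form \<Rightarrow> 'a form" where
  "form_add t s = (fst t \<inter> fst s,
     \<lambda>x y. if x \<in> fst t \<inter> fst s \<and> y \<in> fst t \<inter> fst s then snd t x y + snd s x y else 0)"

definition zero_form :: "'a::chilbert form" where
  "zero_form = (UNIV, \<lambda>_ _. 0)"

definition Vf :: "'a::chilbert form set" where
  "Vf = {t. positive_form t \<and> (bounded_form t \<longrightarrow> fst t = UNIV)}"

definition oplus_defined :: "'a::chilbert form \<Rightarrow> 'a form \<Rightarrow> bool" where
  "oplus_defined t s \<longleftrightarrow> bounded_form t \<or> bounded_form s \<or> fst t = fst s"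

definition m_form :: "'a::chilbert form \<Rightarrow> real" where
  "m_form t = Inf {Re (snd t x x) | x. x \<in> fst t \<and> norm x = 1}"

text \<open>Norm of x induced by the inner product (x,y)_t = t(x,y) + (1 + m_t)(x,y).\<close>
definition form_norm :: "'a::chilbert form \<Rightarrow> 'a \<Rightarrow> real" where
  "form_norm t x = sqrt (Re (snd t x x) + (1 + m_form t) * (norm x)\<^sup>2)"

definition closed_form :: "'a::chilbert form \<Rightarrow> bool" where
  "closed_form t \<longleftrightarrow> positive_form t \<and>
     (\<forall>f. (\<forall>n. f n \<in> fst t) \<longrightarrow>
          (\<forall>e>0. \<exists>N. \<forall>m\<ge>N. \<forall>n\<ge>N. form_norm t (f m - f n) < e) \<longrightarrow>
          (\<exists>x\<in>fst t. (\<lambda>n. form_norm t (f n - x)) \<longlonglongrightarrow> 0))"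

definition form_extends :: "'a::chilbert form \<Rightarrow> 'a form \<Rightarrow> bool" where
  "form_extends s t \<longleftrightarrow> fst t \<subseteq> fst s \<and> (\<forall>x\<in>fst t. \<forall>y\<in>fst t. snd s x y = snd t x y)"

definition closable_form :: "'a::chilbert form \<Rightarrow> bool" where
  "closable_form t \<longleftrightarrow> (\<exists>s. closed_form s \<and> form_extends s t)"

definition is_regular_part :: "'a::chilbert form \<Rightarrow> 'a form \<Rightarrow> bool" where
  "is_regular_part t r \<longleftrightarrow>
     positive_form r \<and> closable_form r \<and> fst r = fst t \<and>
     (\<forall>x\<in>fst t. Re (snd r x x) \<le> Re (snd t x x)) \<and>
     (\<forall>s. positive_form s \<and> closable_form s \<and> fst s = fst t \<and>
          (\<forall>x\<in>fst t. Re (snd s x x) \<le> Re (snd t x x)) \<longrightarrow>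
          (\<forall>x\<in>fst t. Re (snd s x x) \<le> Re (snd r x x)))"

definition regular_part :: "'a::chilbert form \<Rightarrow> 'a form" where
  "regular_part t = (THE r. is_regular_part t r)"

definition oplus_bar :: "'a::chilbert form \<Rightarrow> 'a form \<Rightarrow> 'a form option" where
  "oplus_bar t s =
     (if t \<in> Vf \<and> s \<in> Vf \<and> oplus_defined t s \<and>
         regular_part (form_add t s) = form_add (regular_part t) (regular_part s)
      then Some (form_add t s) else None)"

definition gea_le :: "'x set \<Rightarrow> ('x \<Rightarrow> 'x \<Rightarrow> 'x option) \<Rightarrow> 'x \<Rightarrow> 'x \<Rightarrow> bool" where
  "gea_le E op a b \<longleftrightarrow> (\<exists>c\<in>E. op a c = Some b)"

definition mono_dedekind_down_sigma_complete ::
    "'x set \<Rightarrow> ('x \<Rightarrow> 'x \<Rightarrow> 'x option) \<Rightarrow> bool" where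
  "mono_dedekind_down_sigma_complete E op \<longleftrightarrow>
     (\<forall>f. (\<forall>n. f n \<in> E) \<longrightarrow> (\<forall>n. gea_le E op (f (Suc n)) (f n)) \<longrightarrow>
        (\<exists>t\<in>E. (\<forall>n. gea_le E op t (f n)) \<and>
               (\<forall>s\<in>E. (\<forall>n. gea_le E op s (f n)) \<longrightarrow> gea_le E op s t)))"

end

(* Take an orthonormal sequence e and, on the dense subspace D of all x with
   Q x = sum 2^k |<x, e k>|^2 finite, the closed form S with S(x,x) = Q x and the functional
   phi x = sum <x, e k>. Then |phi|^2 is bounded by 2 Q, so every c S + d |phi|^2 with c > 0 is
   closed, while |phi|^2 itself has regular part 0. The sequence (1 + 1/(n+1)) (S + |phi|^2)
   decreases and has the lower bounds S + |phi|^2 and S. The first one forces the infimum to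
   be S + |phi|^2, but S is not below it in the induced order: the only candidate
   complement |phi|^2 has regular part 0, whereas S and S + |phi|^2 are their own regular parts. *)

theory Submission
  imports Defs
begin

section \<open>Complex Hilbert spaces\<close>

lemma cinner_add_right: "cinner x (y + z) = cinner x y + cinner x z"
  for x :: "'a::chilbert"
  by (metis cinner_commute cinner_add_left complex_cnj_add)

lemma cinner_scaleC_right: "cinner x (c *\<^sub>C y) = cnj c * cinner x y"
  for x :: "'a::chilbert"
  by (metis cinner_commute cinner_scaleC_left complex_cnj_mult)

lemma minus_eq_scaleC: "- x = (- 1) *\<^sub>C x" for x :: "'a::chilbert"
  using scaleR_scaleC[of "-1" x] by simp

lemma scaleC_zero_left [simp]: "0 *\<^sub>C x = 0" for x :: "'a::chilbert"
  using scaleR_scaleC[of 0 x] by simp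

lemma cinner_minus_left: "cinner (- x) y = - cinner x y" for x :: "'a::chilbert"
  by (simp add: minus_eq_scaleC cinner_scaleC_left)

lemma cinner_diff_left: "cinner (x - y) z = cinner x z - cinner y z" for x :: "'a::chilbert"
  by (metis cinner_add_left cinner_minus_left diff_conv_add_uminus)

lemma cinner_zero_left [simp]: "cinner 0 y = 0" for y :: "'a::chilbert"
  using cinner_scaleC_left[of 0 y y] by simp

lemma cinner_self: "cinner x x = complex_of_real ((norm x)\<^sup>2)" for x :: "'a::chilbert"
proof -
  have "Im (cinner x x) = - Im (cinner x x)"
    using arg_cong[OF cinner_commute[of x x], of Im] by simp
  then show ?thesis
    by (simp add: complex_eq_iff norm_eq_sqrt_cinner cinner_ge_zero)
qed

lemma cinner_sum_left: "cinner (sum f A) y = (\<Sum>i\<in>A. cinner (f i) y)"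
  for y :: "'a::chilbert"
  by (induction A rule: infinite_finite_induct) (auto simp: cinner_add_left)

lemma norm_scaleC: "norm (c *\<^sub>C x) = cmod c * norm x" for x :: "'a::chilbert"
proof -
  have "complex_of_real ((norm (c *\<^sub>C x))\<^sup>2) = complex_of_real ((cmod c * norm x)\<^sup>2)"
    unfolding cinner_self[symmetric] cinner_scaleC_left cinner_scaleC_right
    unfolding cinner_self using complex_norm_square[of c]
    by (simp add: power_mult_distrib mult_ac)
  then have "(norm (c *\<^sub>C x))\<^sup>2 = (cmod c * norm x)\<^sup>2"
    using of_real_eq_iff by blast
  then show ?thesis by (simp add: power2_eq_iff_nonneg)
qed

lemma norm_add_orthogonal:
  fixes x :: "'a::chilbert"
  assumes "cinner x y = 0"
  shows "(norm (x + y))\<^sup>2 = (norm x)\<^sup>2 + (norm y)\<^sup>2"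
proof -
  have "cinner y x = 0" using assms cinner_commute[of y x] by simp
  then have "complex_of_real ((norm (x + y))\<^sup>2) = complex_of_real ((norm x)\<^sup>2 + (norm y)\<^sup>2)"
    using assms by (simp only: cinner_self[symmetric] cinner_add_left cinner_add_right of_real_add) simp
  then show ?thesis using of_real_eq_iff by blast
qed

lemma csubspace_minus: "csubspace D \<Longrightarrow> x \<in> D \<Longrightarrow> - x \<in> D"
  unfolding csubspace_def by (simp add: minus_eq_scaleC)

lemma csubspace_diff: "csubspace D \<Longrightarrow> x \<in> D \<Longrightarrow> y \<in> D \<Longrightarrow> x - y \<in> D"
  by (metis csubspace_def csubspace_minus diff_conv_add_uminus)

section \<open>Forms and regular parts\<close>

lemma positive_formD:
  assumes "positive_form t"
  shows "csubspace (fst t)" "closure (fst t) = UNIV"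
    and "\<And>x y z. x \<in> fst t \<Longrightarrow> y \<in> fst t \<Longrightarrow> z \<in> fst t \<Longrightarrow> snd t (x + y) z = snd t x z + snd t y z"
    and "\<And>x y z. x \<in> fst t \<Longrightarrow> y \<in> fst t \<Longrightarrow> z \<in> fst t \<Longrightarrow> snd t x (y + z) = snd t x y + snd t x z"
    and "\<And>x y c. x \<in> fst t \<Longrightarrow> y \<in> fst t \<Longrightarrow> snd t (c *\<^sub>C x) y = c * snd t x y"
    and "\<And>x y c. x \<in> fst t \<Longrightarrow> y \<in> fst t \<Longrightarrow> snd t x (c *\<^sub>C y) = cnj c * snd t x y"
    and "\<And>x y. x \<notin> fst t \<or> y \<notin> fst t \<Longrightarrow> snd t x y = 0"
    and "\<And>x. x \<in> fst t \<Longrightarrow> snd t x x = complex_of_real (Re (snd t x x))"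
    and "\<And>x. x \<in> fst t \<Longrightarrow> 0 \<le> Re (snd t x x)"
  using assms unfolding positive_form_def is_form_def by auto

text \<open>Polarization: expanding the diagonal at \<open>x + y\<close> and at
  \<open>x + \<i> *\<^sub>C y\<close> recovers the sum and the difference of the two mixed values.
  Outside the common domain both value functions are 0 by convention, so the pairs agree
  everywhere.\<close>

lemma positive_form_eqI:
  fixes r t :: "'a::chilbert form"
  assumes t: "positive_form t" and r: "positive_form r" and dom: "fst r = fst t"
    and diag: "\<And>x. x \<in> fst t \<Longrightarrow> Re (snd r x x) = Re (snd t x x)"
  shows "r = t"
proof -
  have dg: "snd r x x = snd t x x" if "x \<in> fst t" for x
    using positive_formD(8)[OF t that] positive_formD(8)[OF r] diag that dom by metis
  have "snd r x y = snd t x y" if x: "x \<in> fst t" and y: "y \<in> fst t" for x y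
  proof -
    have expand: "snd u (x + z) (x + z) = snd u x x + snd u x z + snd u z x + snd u z z"
      if "positive_form u" "fst u = fst t" "z \<in> fst t" for z u
    proof -
      have "x + z \<in> fst u"
        using that x positive_formD(1)[OF that(1)] unfolding csubspace_def by auto
      then show ?thesis
        using that x by (simp add: positive_formD(3,4)[OF that(1)])
    qed
    have cross: "snd r x z + snd r z x = snd t x z + snd t z x" if z: "z \<in> fst t" for z
    proof -
      have "x + z \<in> fst t"
        using z x positive_formD(1)[OF t] unfolding csubspace_def by auto
      then show ?thesis
        using expand[OF t refl z] expand[OF r dom z] dg[OF x] dg[OF z] dg[of "x + z"]
        by (simp add: algebra_simps)
    qed
    have iy: "\<i> *\<^sub>C y \<in> fst t" using y positive_formD(1)[OF t] unfolding csubspace_def by auto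
    have "snd r x y + snd r y x = snd t x y + snd t y x" by (rule cross[OF y])
    moreover have "\<i> * (snd r y x - snd r x y) = \<i> * (snd t y x - snd t x y)"
      using cross[OF iy] positive_formD(5,6)[OF t] positive_formD(5,6)[OF r] x y dom
      by (simp add: algebra_simps)
    then have "snd r y x - snd r x y = snd t y x - snd t x y" by simp
    ultimately have "2 * snd r x y = 2 * snd t x y" by algebra
    then show ?thesis by simp
  qed
  then have "snd r x y = snd t x y" for x y
    using positive_formD(7)[OF t, of x y] positive_formD(7)[OF r, of x y] dom by (cases "x \<in> fst t \<and> y \<in> fst t") auto
  then show ?thesis using dom by (simp add: prod_eq_iff fun_eq_iff)
qed

text \<open>Nonnegativity at \<open>x - y\<close> bounds the mixed terms by the diagonal
  ones.\<close>

lemma positive_form_add_le: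
  assumes t: "positive_form t" and x: "x \<in> fst t" and y: "y \<in> fst t"
  shows "Re (snd t (x + y) (x + y)) \<le> 2 * Re (snd t x x) + 2 * Re (snd t y y)"
proof -
  note cs = positive_formD(1)[OF t]
  have my: "(- 1) *\<^sub>C y \<in> fst t" using cs y unfolding csubspace_def by auto
  have xy: "x + y \<in> fst t" "x + (- 1) *\<^sub>C y \<in> fst t"
    using cs x y my unfolding csubspace_def by auto
  have 1: "snd t (x + y) (x + y) = snd t x x + snd t x y + snd t y x + snd t y y"
    using x y xy by (simp add: positive_formD(3,4)[OF t])
  have 2: "snd t (x + (- 1) *\<^sub>C y) (x + (- 1) *\<^sub>C y) = snd t x x - snd t x y - snd t y x + snd t y y"
    using x y xy my by (simp add: positive_formD(3,4)[OF t] positive_formD(5,6)[OF t])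
  have "0 \<le> Re (snd t (x + (- 1) *\<^sub>C y) (x + (- 1) *\<^sub>C y))"
    by (rule positive_formD(9)[OF t xy(2)])
  then show ?thesis unfolding 1 2 by simp
qed

text \<open>Two largest elements have the same diagonal, hence coincide by polarization; so the
  description operator picks out \<open>r\<close>.\<close>

lemma regular_part_eqI:
  assumes "is_regular_part t r"
  shows "regular_part t = r"
  unfolding regular_part_def
proof (rule the_equality)
  fix u assume u: "is_regular_part t u"
  show "u = r"
  proof (rule positive_form_eqI)
    show "positive_form r" "positive_form u" "fst u = fst r"
      using u assms unfolding is_regular_part_def by auto
    fix x assume "x \<in> fst r"
    then show "Re (snd u x x) = Re (snd r x x)"
      using u assms unfolding is_regular_part_def by (metis antisym)
  qed
qed fact

text \<open>A closed form extends itself, hence is closable and trivially the largest closable form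
  below itself.\<close>

lemma regular_part_closed:
  assumes "closed_form t"
  shows "regular_part t = t"
proof (rule regular_part_eqI)
  have "closable_form t" using assms unfolding closable_form_def form_extends_def by blast
  then show "is_regular_part t t"
    using assms unfolding is_regular_part_def closed_form_def by auto
qed

text \<open>The unit vector keeps the set under \<open>Inf\<close> nonempty; the infimum of the
  empty set of reals would carry no information.\<close>

lemma m_form_nonneg:
  assumes "positive_form t" "x \<in> fst t" "norm x = 1"
  shows "0 \<le> m_form t"
  unfolding m_form_def by (rule cInf_greatest) (use assms positive_formD(9)[OF assms(1)] in auto)

section \<open>Orthonormal sequences\<close>

text \<open>Gram-Schmidt inside dependent choice: finitely many vectors never span the space, so a
  vector outside their span leaves a nonzero remainder to normalize.\<close>

lemma exists_orthonormal_sequence: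
  assumes "\<not> finite_dimensional_H TYPE('a::chilbert)"
  shows "\<exists>e :: nat \<Rightarrow> 'a. \<forall>n. norm (e n) = 1 \<and> (\<forall>k<n. cinner (e n) (e k) = 0)"
proof (rule dependent_wellorder_choice)
  fix f :: "nat \<Rightarrow> 'a" and n
  assume f: "\<And>k. k < n \<Longrightarrow> norm (f k) = 1 \<and> (\<forall>j<k. cinner (f k) (f j) = 0)"
  have orth: "cinner (f j) (f k) = (if j = k then 1 else 0)" if "j < n" "k < n" for j k
  proof (cases j k rule: linorder_cases)
    case less
    then show ?thesis using f[OF that(2)] cinner_commute[of "f j" "f k"] by auto
  next
    case equal
    then show ?thesis using f[OF that(1)] by (simp add: cinner_self)
  next
    case greater
    then show ?thesis using f[OF that(1)] by auto
  qed
  \<comment> \<open>Finite dimension is phrased with sums over a set of vectors, so passing to sums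
    over indices requires injectivity.\<close>
  have inj: "inj_on f {..<n}"
    by (rule inj_onI) (metis lessThan_iff orth zero_neq_one)
  obtain x where x: "\<And>c. x \<noteq> (\<Sum>b\<in>f ` {..<n}. c b *\<^sub>C b)"
    using assms unfolding finite_dimensional_H_def by (metis finite_imageI finite_lessThan)
  define v where "v = x - (\<Sum>k<n. cinner x (f k) *\<^sub>C f k)"
  have "(\<Sum>b\<in>f ` {..<n}. cinner x b *\<^sub>C b) = (\<Sum>k<n. cinner x (f k) *\<^sub>C f k)"
    by (simp add: sum.reindex[OF inj])
  then have v0: "norm v \<noteq> 0" using x[of "cinner x"] unfolding v_def by auto
  have v: "cinner v (f j) = 0" if j: "j < n" for j
  proof -
    have "(\<Sum>k<n. cinner (cinner x (f k) *\<^sub>C f k) (f j)) = (\<Sum>k<n. if k = j then cinner x (f k) else 0)"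
      by (rule sum.cong) (use j in \<open>auto simp: cinner_scaleC_left orth\<close>)
    then show ?thesis using j by (simp add: v_def cinner_diff_left cinner_sum_left)
  qed
  have "norm (complex_of_real (1 / norm v) *\<^sub>C v) = 1"
    using v0 by (simp add: norm_scaleC norm_divide)
  moreover have "\<forall>k<n. cinner (complex_of_real (1 / norm v) *\<^sub>C v) (f k) = 0"
    using v by (simp add: cinner_scaleC_left)
  ultimately show "\<exists>r. norm r = 1 \<and> (\<forall>k<n. cinner r (f k) = 0)" by blast
qed auto

locale orthonormal_sequence =
  fixes e :: "nat \<Rightarrow> 'a::chilbert"
  assumes norm_e: "norm (e n) = 1"
    and orth: "k < n \<Longrightarrow> cinner (e n) (e k) = 0"
begin

definition coef :: "nat \<Rightarrow> 'a \<Rightarrow> complex" where "coef k x = cinner x (e k)"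

definition comb :: "(nat \<Rightarrow> complex) \<Rightarrow> nat \<Rightarrow> 'a" where "comb c n = (\<Sum>k<n. c k *\<^sub>C e k)"

lemma coef_e: "coef k (e j) = (if j = k then 1 else 0)"
proof (cases j k rule: linorder_cases)
  case less
  then show ?thesis using orth[of j k] cinner_commute[of "e j" "e k"] by (auto simp: coef_def)
qed (auto simp: coef_def cinner_self norm_e orth)

lemma coef_add: "coef k (x + y) = coef k x + coef k y"
  and coef_diff: "coef k (x - y) = coef k x - coef k y"
  and coef_scaleC: "coef k (c *\<^sub>C x) = c * coef k x"
  and coef_zero [simp]: "coef k 0 = 0"
  by (simp_all add: coef_def cinner_add_left cinner_diff_left cinner_scaleC_left)

lemma coef_sum: "finite A \<Longrightarrow> coef j (\<Sum>k\<in>A. c k *\<^sub>C e k) = (if j \<in> A then c j else 0)"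
proof (induction A rule: finite_induct)
  case (insert i A)
  then show ?case by (auto simp: coef_add coef_scaleC coef_e)
qed simp

lemma coef_comb: "coef j (comb c n) = (if j < n then c j else 0)"
  by (simp add: comb_def coef_sum)

lemma norm_sum_e: "finite A \<Longrightarrow> (norm (\<Sum>k\<in>A. c k *\<^sub>C e k))\<^sup>2 = (\<Sum>k\<in>A. (cmod (c k))\<^sup>2)"
proof (induction A rule: finite_induct)
  case (insert i A)
  have "coef i (\<Sum>k\<in>A. c k *\<^sub>C e k) = 0" using insert coef_sum by simp
  then have "cinner (\<Sum>k\<in>A. c k *\<^sub>C e k) (c i *\<^sub>C e i) = 0"
    by (simp add: cinner_scaleC_right coef_def)
  from norm_add_orthogonal[OF this] show ?case
    using insert by (simp add: norm_scaleC norm_e add.commute)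
qed simp

text \<open>The truncated expansion \<open>?p\<close> is orthogonal to \<open>x - ?p\<close>, so
  Pythagoras gives \<open>norm ?p \<le> norm x\<close>.\<close>

lemma bessel: "(\<Sum>k<n. (cmod (coef k x))\<^sup>2) \<le> (norm x)\<^sup>2"
proof -
  let ?p = "comb (\<lambda>k. coef k x) n"
  have "coef k (x - ?p) = 0" if "k < n" for k
    using that by (simp add: coef_diff coef_comb)
  then have "cinner ?p (x - ?p) = 0"
    by (subst comb_def)
      (simp add: cinner_sum_left cinner_scaleC_left coef_def cinner_commute[of "e _"])
  from norm_add_orthogonal[OF this] have "(norm ?p)\<^sup>2 \<le> (norm x)\<^sup>2" by simp
  then show ?thesis by (simp add: comb_def norm_sum_e)
qed

lemma summable_coef: "summable (\<lambda>k. (cmod (coef k x))\<^sup>2)"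
  by (rule bounded_imp_summable[of _ "(norm x)\<^sup>2"])
    (use bessel[of x "Suc _"] in \<open>auto simp: lessThan_Suc_atMost\<close>)

lemma norm_coef_le: "cmod (coef k x) \<le> norm x"
proof -
  have "(cmod (coef k x))\<^sup>2 \<le> (\<Sum>k<Suc k. (cmod (coef k x))\<^sup>2)"
    by (rule member_le_sum) auto
  also have "\<dots> \<le> (norm x)\<^sup>2" by (rule bessel)
  finally show ?thesis by (simp add: power2_le_iff_abs_le)
qed

lemma tendsto_coef:
  assumes "f \<longlonglongrightarrow> x"
  shows "(\<lambda>n. coef k (f n)) \<longlonglongrightarrow> coef k x"
proof -
  have "(\<lambda>n. norm (f n - x)) \<longlonglongrightarrow> 0"
    using assms by (simp add: LIM_zero_iff tendsto_norm_zero_iff)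
  then have "(\<lambda>n. coef k (f n) - coef k x) \<longlonglongrightarrow> 0"
    by (rule Lim_null_comparison[rotated]) (use norm_coef_le[of k "f _ - x"] in \<open>simp add: coef_diff\<close>)
  then show ?thesis by (simp add: LIM_zero_iff)
qed

text \<open>By Pythagoras the blocks of the series are controlled by blocks of the Bessel series,
  and completeness does the rest. The limit is the projection of \<open>x\<close> to the closed span
  of the \<open>e k\<close>, which may differ from \<open>x\<close>.\<close>

lemma comb_coef_convergent: "convergent (comb (\<lambda>k. coef k x))"
proof -
  have "summable (\<lambda>k. coef k x *\<^sub>C e k)"
    unfolding summable_Cauchy
  proof (intro allI impI)
    fix r :: real assume r: "0 < r"
    then obtain N where N: "\<And>m n. m \<ge> N \<Longrightarrow> norm (\<Sum>k=m..<n. (cmod (coef k x))\<^sup>2) < r\<^sup>2"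
      using summable_coef[of x] unfolding summable_Cauchy by (metis zero_less_power)
    have "norm (\<Sum>k=m..<n. coef k x *\<^sub>C e k) < r" if "m \<ge> N" for m n
    proof -
      have "(norm (\<Sum>k=m..<n. coef k x *\<^sub>C e k))\<^sup>2 < r\<^sup>2"
        using N[OF that, of n] by (simp add: norm_sum_e)
      then show ?thesis using r by (simp add: power_less_imp_less_base)
    qed
    then show "\<exists>N. \<forall>m\<ge>N. \<forall>n. norm (\<Sum>k=m..<n. coef k x *\<^sub>C e k) < r" by blast
  qed
  then show ?thesis by (simp add: summable_iff_convergent comb_def[abs_def])
qed

section \<open>A weighted diagonal form and a rank-one form\<close>

text \<open>The form domain of the diagonal operator with eigenvalues \<open>2 ^ k\<close>. The
  sequence \<open>e\<close> need not be a basis: vectors orthogonal to every \<open>e k\<close>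
  belong to \<open>D\<close>, and \<open>Q\<close> vanishes on them.\<close>

definition D :: "'a set" where "D = {x. summable (\<lambda>k. 2 ^ k * (cmod (coef k x))\<^sup>2)}"

definition S :: "'a \<Rightarrow> 'a \<Rightarrow> complex" where
  "S x y = (\<Sum>k. 2 ^ k * (coef k x * cnj (coef k y)))"

definition Q :: "'a \<Rightarrow> real" where "Q x = (\<Sum>k. 2 ^ k * (cmod (coef k x))\<^sup>2)"

text \<open>Convergence of this series is guaranteed only on \<open>D\<close>, by the growth of the
  weights; every use stays inside \<open>D\<close>.\<close>

definition \<phi> :: "'a \<Rightarrow> complex" where "\<phi> x = (\<Sum>k. coef k x)"

definition F :: "real \<Rightarrow> real \<Rightarrow> 'a form" where
  "F c d = (D, \<lambda>x y. if x \<in> D \<and> y \<in> D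
     then complex_of_real c * S x y + complex_of_real d * (\<phi> x * cnj (\<phi> y)) else 0)"

lemma csubspace_D: "csubspace D"
  unfolding csubspace_def
proof (intro conjI ballI allI)
  show "0 \<in> D" by (simp add: D_def)
next
  fix x y assume x: "x \<in> D" and y: "y \<in> D"
  have "summable (\<lambda>k. 2 * (2 ^ k * (cmod (coef k x))\<^sup>2) + 2 * (2 ^ k * (cmod (coef k y))\<^sup>2))"
    using x y unfolding D_def by (intro summable_add summable_mult) auto
  then show "x + y \<in> D"
    unfolding D_def mem_Collect_eq
  proof (rule summable_comparison_test[rotated], intro exI[of _ 0] allI impI)
    fix k :: nat
    let ?a = "cmod (coef k x)" and ?b = "cmod (coef k y)"
    have "(cmod (coef k (x + y)))\<^sup>2 \<le> (?a + ?b)\<^sup>2"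
      unfolding coef_add by (intro power_mono norm_triangle_ineq norm_ge_zero)
    also have "\<dots> \<le> 2 * ?a\<^sup>2 + 2 * ?b\<^sup>2"
      using sum_squares_ge_zero[of "?a - ?b" 0] by (simp add: power2_eq_square algebra_simps)
    finally have "2 ^ k * (cmod (coef k (x + y)))\<^sup>2 \<le> 2 ^ k * (2 * ?a\<^sup>2 + 2 * ?b\<^sup>2)"
      by (intro mult_left_mono) auto
    then show "norm (2 ^ k * (cmod (coef k (x + y)))\<^sup>2) \<le> 2 * (2 ^ k * ?a\<^sup>2) + 2 * (2 ^ k * ?b\<^sup>2)"
      by (simp add: algebra_simps)
  qed
next
  fix c x assume "x \<in> D"
  then have "summable (\<lambda>k. (cmod c)\<^sup>2 * (2 ^ k * (cmod (coef k x))\<^sup>2))"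
    unfolding D_def by (intro summable_mult) auto
  then show "c *\<^sub>C x \<in> D"
    by (simp add: D_def coef_scaleC norm_mult power_mult_distrib algebra_simps)
qed

lemma D_add: "x \<in> D \<Longrightarrow> y \<in> D \<Longrightarrow> x + y \<in> D"
  and D_scaleC: "x \<in> D \<Longrightarrow> c *\<^sub>C x \<in> D"
  using csubspace_D unfolding csubspace_def by auto

lemmas D_diff = csubspace_diff[OF csubspace_D]

lemma comb_in_D: "comb c n \<in> D"
proof -
  have "summable (\<lambda>k. 2 ^ k * (cmod (coef k (comb c n)))\<^sup>2)"
    by (rule summable_finite[of "{..<n}"]) (auto simp: coef_comb)
  then show ?thesis by (simp add: D_def)
qed

lemma e_in_D: "e k \<in> D"
proof -
  have "summable (\<lambda>j. 2 ^ j * (cmod (coef j (e k)))\<^sup>2)"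
    by (rule summable_finite[of "{k}"]) (auto simp: coef_e)
  then show ?thesis by (simp add: D_def)
qed

text \<open>Truncated expansions alone tend only to the projection \<open>z\<close>. Adding the part
  \<open>x - z\<close>, whose coefficients all vanish, leaves them in \<open>D\<close> and moves the
  limit to \<open>x\<close>.\<close>

lemma closure_D: "closure D = UNIV"
proof -
  have "x \<in> closure D" for x
  proof -
    let ?p = "comb (\<lambda>k. coef k x)"
    obtain z where z: "?p \<longlonglongrightarrow> z" using comb_coef_convergent convergent_def by blast
    have cz: "coef j z = coef j x" for j
    proof (rule LIMSEQ_unique[OF tendsto_coef[OF z]])
      show "(\<lambda>n. coef j (?p n)) \<longlonglongrightarrow> coef j x"
        by (rule tendsto_eventually, rule eventually_sequentiallyI[of "Suc j"])
          (simp add: coef_comb)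
    qed
    have "(\<lambda>n. x - z + ?p n) \<longlonglongrightarrow> x - z + z" by (intro tendsto_intros z)
    moreover have "x - z + ?p n \<in> D" for n
    proof -
      have "coef j (x - z + ?p n) = coef j (?p n)" for j by (simp add: coef_add coef_diff cz)
      then show ?thesis using comb_in_D[of _ n] by (simp add: D_def)
    qed
    ultimately show ?thesis unfolding closure_sequential by (metis diff_add_cancel)
  qed
  then show ?thesis by auto
qed

lemma summable_S:
  assumes "x \<in> D" "y \<in> D"
  shows "summable (\<lambda>k. 2 ^ k * (coef k x * cnj (coef k y)))"
proof (rule summable_comparison_test, intro exI[of _ 0] allI impI)
  show "summable (\<lambda>k. 2 ^ k * (cmod (coef k x))\<^sup>2 + 2 ^ k * (cmod (coef k y))\<^sup>2)"
    using assms unfolding D_def by (intro summable_add) auto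
  fix k :: nat
  let ?a = "cmod (coef k x)" and ?b = "cmod (coef k y)"
  have "?a * ?b \<le> ?a\<^sup>2 + ?b\<^sup>2"
    using sum_squares_bound[of ?a ?b] mult_nonneg_nonneg[of ?a ?b, OF norm_ge_zero norm_ge_zero]
    by linarith
  then have "2 ^ k * (?a * ?b) \<le> 2 ^ k * (?a\<^sup>2 + ?b\<^sup>2)"
    by (intro mult_left_mono) auto
  then show "norm (2 ^ k * (coef k x * cnj (coef k y))) \<le> 2 ^ k * ?a\<^sup>2 + 2 ^ k * ?b\<^sup>2"
    by (simp add: norm_mult norm_power algebra_simps)
qed

lemma S_add_left: "x \<in> D \<Longrightarrow> y \<in> D \<Longrightarrow> z \<in> D \<Longrightarrow> S (x + y) z = S x z + S y z"
  unfolding S_def by (subst suminf_add) (auto simp: summable_S coef_add distrib_left distrib_right)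

lemma S_add_right: "x \<in> D \<Longrightarrow> y \<in> D \<Longrightarrow> z \<in> D \<Longrightarrow> S x (y + z) = S x y + S x z"
  unfolding S_def by (subst suminf_add) (auto simp: summable_S coef_add distrib_left distrib_right)

lemma S_scaleC_left: "x \<in> D \<Longrightarrow> y \<in> D \<Longrightarrow> S (c *\<^sub>C x) y = c * S x y"
  unfolding S_def by (subst suminf_mult[symmetric]) (auto simp: summable_S coef_scaleC mult.assoc mult.left_commute[of c])

lemma S_scaleC_right: "x \<in> D \<Longrightarrow> y \<in> D \<Longrightarrow> S x (c *\<^sub>C y) = cnj c * S x y"
  unfolding S_def by (subst suminf_mult[symmetric]) (auto simp: summable_S coef_scaleC mult.left_commute[of _ "cnj c"])

lemma S_self: "x \<in> D \<Longrightarrow> S x x = complex_of_real (Q x)"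
  unfolding S_def Q_def D_def by (subst suminf_of_real) (auto simp flip: complex_norm_square)

lemma Q_nonneg: "x \<in> D \<Longrightarrow> 0 \<le> Q x"
  unfolding Q_def D_def by (intro suminf_nonneg) auto

lemma Q_partial: "x \<in> D \<Longrightarrow> (\<Sum>k<n. 2 ^ k * (cmod (coef k x))\<^sup>2) \<le> Q x"
  unfolding Q_def D_def by (intro sum_le_suminf) auto

text \<open>Cauchy-Schwarz with \<open>1 = sqrt ((1/2) ^ k) * sqrt (2 ^ k)\<close>; the factor 2 is
  the sum of the geometric series.\<close>

lemma sum_cmod_coef_le:
  assumes "x \<in> D"
  shows "(\<Sum>k<n. cmod (coef k x)) \<le> sqrt (2 * Q x)"
proof (rule real_le_rsqrt)
  have "(\<Sum>k<n. cmod (coef k x))\<^sup>2 = (\<Sum>k<n. sqrt ((1/2) ^ k) * (sqrt (2 ^ k) * cmod (coef k x)))\<^sup>2"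
    by (simp add: real_sqrt_power[symmetric] power_mult_distrib[symmetric] real_sqrt_mult[symmetric] mult.assoc[symmetric])
  also have "\<dots> \<le> (\<Sum>k<n. (sqrt ((1/2) ^ k))\<^sup>2) * (\<Sum>k<n. (sqrt (2 ^ k) * cmod (coef k x))\<^sup>2)"
    by (rule Cauchy_Schwarz_ineq_sum)
  also have "\<dots> = (\<Sum>k<n. (1/2) ^ k) * (\<Sum>k<n. 2 ^ k * (cmod (coef k x))\<^sup>2)"
    by (simp add: power_mult_distrib)
  also have "\<dots> \<le> 2 * Q x"
  proof (rule mult_mono[OF _ Q_partial[OF assms]])
    have "(\<Sum>k<n. (1/2) ^ k) \<le> (\<Sum>k. (1/2::real) ^ k)"
      by (intro sum_le_suminf summable_geometric) auto
    then show "(\<Sum>k<n. (1/2) ^ k) \<le> (2::real)" by (simp add: suminf_geometric)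
  qed (auto intro: sum_nonneg)
  finally show "(\<Sum>k<n. cmod (coef k x))\<^sup>2 \<le> 2 * Q x" .
qed

lemma summable_cmod_coef: "x \<in> D \<Longrightarrow> summable (\<lambda>k. cmod (coef k x))"
  by (rule bounded_imp_summable[of _ "sqrt (2 * Q x)"])
    (use sum_cmod_coef_le[of x "Suc _"] in \<open>auto simp: lessThan_Suc_atMost\<close>)

lemma summable_coef_D: "x \<in> D \<Longrightarrow> summable (\<lambda>k. coef k x)"
  by (rule summable_norm_cancel) (rule summable_cmod_coef)

text \<open>Although unbounded for the norm of the space, \<open>\<phi>\<close> is thus continuous
  for the form norm of \<open>S\<close>. This is what lets \<open>S\<close> absorb the rank-one term
  in \<open>closed_F\<close>.\<close>

lemma \<phi>_bound:
  assumes "x \<in> D"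
  shows "(cmod (\<phi> x))\<^sup>2 \<le> 2 * Q x"
proof -
  have "cmod (\<phi> x) \<le> (\<Sum>k. cmod (coef k x))"
    unfolding \<phi>_def by (rule summable_norm[OF summable_cmod_coef[OF assms]])
  also have "\<dots> \<le> sqrt (2 * Q x)"
    by (rule suminf_le_const[OF summable_cmod_coef[OF assms] sum_cmod_coef_le[OF assms]])
  finally have "(cmod (\<phi> x))\<^sup>2 \<le> (sqrt (2 * Q x))\<^sup>2" by (intro power_mono) auto
  then show ?thesis using Q_nonneg[OF assms] by simp
qed

lemma \<phi>_add: "x \<in> D \<Longrightarrow> y \<in> D \<Longrightarrow> \<phi> (x + y) = \<phi> x + \<phi> y"
  unfolding \<phi>_def by (subst suminf_add) (auto simp: summable_coef_D coef_add)

lemma \<phi>_diff: "x \<in> D \<Longrightarrow> y \<in> D \<Longrightarrow> \<phi> (x - y) = \<phi> x - \<phi> y"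
  unfolding \<phi>_def by (subst suminf_diff) (auto simp: summable_coef_D coef_diff)

lemma \<phi>_scaleC: "x \<in> D \<Longrightarrow> \<phi> (c *\<^sub>C x) = c * \<phi> x"
  unfolding \<phi>_def by (subst suminf_mult[symmetric]) (auto simp: summable_coef_D coef_scaleC)

lemma \<phi>_comb: "\<phi> (comb c n) = (\<Sum>k<n. c k)"
  unfolding \<phi>_def by (subst suminf_finite[of "{..<n}"]) (auto simp: coef_comb)

section \<open>The two-parameter family \<open>F c d\<close> of forms\<close>

lemma fst_F [simp]: "fst (F c d) = D"
  by (simp add: F_def)

lemma snd_F: "x \<in> D \<Longrightarrow> y \<in> D \<Longrightarrow>
    snd (F c d) x y = complex_of_real c * S x y + complex_of_real d * (\<phi> x * cnj (\<phi> y))"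
  by (simp add: F_def)

lemma F_self: "x \<in> D \<Longrightarrow> snd (F c d) x x = complex_of_real (c * Q x + d * (cmod (\<phi> x))\<^sup>2)"
  by (simp add: snd_F S_self complex_norm_square[symmetric] flip: of_real_power)

lemma Re_F_self: "x \<in> D \<Longrightarrow> Re (snd (F c d) x x) = c * Q x + d * (cmod (\<phi> x))\<^sup>2"
  by (simp only: F_self Re_complex_of_real)

lemma positive_F:
  assumes "0 \<le> c" "0 \<le> d"
  shows "positive_form (F c d)"
  unfolding positive_form_def is_form_def
proof (intro conjI ballI allI impI)
  fix x assume "x \<in> fst (F c d)"
  then have x: "x \<in> D" by simp
  show "snd (F c d) x x \<in> \<real>" by (simp only: F_self[OF x] Reals_of_real)
  show "0 \<le> Re (snd (F c d) x x)" using assms Q_nonneg[OF x] by (simp add: Re_F_self[OF x])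
next
  fix x y assume "x \<notin> fst (F c d) \<or> y \<notin> fst (F c d)"
  then show "snd (F c d) x y = 0" by (auto simp: F_def)
qed (auto simp: csubspace_D closure_D snd_F D_add D_scaleC S_add_left S_add_right
    S_scaleC_left S_scaleC_right \<phi>_add \<phi>_scaleC algebra_simps)

lemma F_add: "form_add (F c d) (F c' d') = F (c + c') (d + d')"
  by (simp add: form_add_def F_def fun_eq_iff algebra_simps)

text \<open>Stated for a form on a possibly larger domain, since \<open>not_le_F\<close> applies it
  to a complement whose domain is not yet known. If \<open>c > 0\<close>, the vectors
  \<open>e n\<close> give values at least \<open>c * 2 ^ n\<close>; if \<open>c = 0\<close>,
  normalized sums of the \<open>e k\<close> make \<open>\<phi>\<close> large.\<close>

lemma not_bounded_on_D:
  assumes "D \<subseteq> fst t" "\<And>x. x \<in> D \<Longrightarrow> Re (snd t x x) = c * Q x + d * (cmod (\<phi> x))\<^sup>2"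
    and "0 \<le> c" "0 \<le> d" "0 < c \<or> 0 < d"
  shows "\<not> bounded_form t"
proof
  assume "bounded_form t"
  then obtain B where B: "\<And>x. x \<in> fst t \<Longrightarrow> norm x = 1 \<Longrightarrow> Re (snd t x x) \<le> B"
    unfolding bounded_form_def bdd_above_def by blast
  have BD: "c * Q x + d * (cmod (\<phi> x))\<^sup>2 \<le> B" if "x \<in> D" "norm x = 1" for x
    using B[of x] assms(1) assms(2)[OF that(1)] that by auto
  show False
  proof (cases "0 < c")
    case True
    obtain n where n: "B / c < 2 ^ n" using real_arch_pow[of 2] by auto
    have "(\<Sum>k<Suc n. 2 ^ k * (cmod (coef k (e n)))\<^sup>2) \<le> Q (e n)" by (rule Q_partial[OF e_in_D])
    moreover have "(\<Sum>k<n. 2 ^ k * (cmod (coef k (e n)))\<^sup>2) \<ge> 0" by (auto intro: sum_nonneg)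
    ultimately have "2 ^ n \<le> Q (e n)" by (simp add: coef_e)
    then have "c * 2 ^ n \<le> c * Q (e n)" using True by simp
    also have "\<dots> \<le> B"
    proof -
      have "0 \<le> d * (cmod (\<phi> (e n)))\<^sup>2" using assms by simp
      then show ?thesis using BD[OF e_in_D norm_e, of n] by linarith
    qed
    finally show False using n True by (simp add: field_simps)
  next
    case False
    then have d: "0 < d" using assms by auto
    obtain n :: nat where n: "B / d < real n" using reals_Archimedean2 by blast
    \<comment> \<open>A unit vector spread evenly over \<open>n + 1\<close> directions, so that
      \<open>\<phi> ?u = sqrt (n + 1)\<close>.\<close>
    let ?u = "comb (\<lambda>_. complex_of_real (1 / sqrt (Suc n))) (Suc n)"
    have u: "(norm ?u)\<^sup>2 = 1"
      unfolding comb_def by (subst norm_sum_e) (simp_all del: of_nat_Suc sum.lessThan_Suc add: norm_divide power_divide)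
    have "\<phi> ?u = complex_of_real (real (Suc n) / sqrt (Suc n))"
      by (simp add: \<phi>_comb del: of_nat_Suc sum.lessThan_Suc)
    then have "\<phi> ?u = complex_of_real (sqrt (Suc n))" by (simp add: real_div_sqrt del: of_nat_Suc)
    then have p: "(cmod (\<phi> ?u))\<^sup>2 = real (Suc n)" by (simp del: of_nat_Suc)
    have "norm ?u = 1" using u by (simp add: power2_eq_1_iff)
        (metis norm_ge_zero not_one_le_zero neg_0_le_iff_le)
    from BD[OF comb_in_D this] have "d * real (Suc n) \<le> B"
      using False Q_nonneg[OF comb_in_D] assms p by (metis add_0 antisym_conv1 mult_zero_left)
    then show False using n d by (simp add: field_simps)
  qed
qed

lemma not_bounded_F: "0 \<le> c \<Longrightarrow> 0 \<le> d \<Longrightarrow> 0 < c \<or> 0 < d \<Longrightarrow> \<not> bounded_form (F c d)"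
  by (rule not_bounded_on_D[of _ c d]) (auto simp: Re_F_self)

lemma F_in_Vf: "0 < c \<Longrightarrow> 0 \<le> d \<Longrightarrow> F c d \<in> Vf"
  unfolding Vf_def using positive_F[of c d] not_bounded_F[of c d] by auto

section \<open>Closedness of \<open>F c d\<close> for positive \<open>c\<close>\<close>

text \<open>Lower semicontinuity of \<open>Q\<close> turns a bound on the differences into one on the limit.\<close>

lemma Q_lim:
  assumes f: "\<And>n. f n \<in> D" and lim: "f \<longlonglongrightarrow> x" and y: "y \<in> D"
    and bd: "\<And>n. n \<ge> N \<Longrightarrow> Q (f n - y) \<le> r"
  shows "x \<in> D" "Q (x - y) \<le> r"
proof -
  have part: "(\<Sum>k<K. 2 ^ k * (cmod (coef k (x - y)))\<^sup>2) \<le> r" for K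
  proof (rule LIMSEQ_le_const2)
    show "(\<lambda>n. \<Sum>k<K. 2 ^ k * (cmod (coef k (f n - y)))\<^sup>2)
        \<longlonglongrightarrow> (\<Sum>k<K. 2 ^ k * (cmod (coef k (x - y)))\<^sup>2)"
      by (intro tendsto_intros tendsto_coef lim)
    show "\<exists>N. \<forall>n\<ge>N. (\<Sum>k<K. 2 ^ k * (cmod (coef k (f n - y)))\<^sup>2) \<le> r"
      using Q_partial[OF D_diff[OF f y]] bd by (meson order_trans)
  qed
  have sm: "summable (\<lambda>k. 2 ^ k * (cmod (coef k (x - y)))\<^sup>2)"
    by (rule bounded_imp_summable[of _ r]) (use part[of "Suc _"] in \<open>auto simp: lessThan_Suc_atMost\<close>)
  then have "x - y \<in> D" by (simp add: D_def)
  then show "x \<in> D" using D_add[OF _ y] by fastforce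
  show "Q (x - y) \<le> r" unfolding Q_def by (rule suminf_le_const[OF sm part])
qed

text \<open>A sequence that is Cauchy in the form norm is Cauchy in the norm and in
  \<open>Q\<close>. Its norm limit is also a \<open>Q\<close>-limit by \<open>Q_lim\<close>, and
  \<open>\<phi>_bound\<close> then handles the rank-one term.\<close>

lemma closed_F:
  assumes c: "0 < c" and d: "0 \<le> d"
  shows "closed_form (F c d)"
  unfolding closed_form_def
proof (intro conjI allI impI)
  show pos: "positive_form (F c d)" using c d by (intro positive_F) auto
  define m where "m = m_form (F c d)"
  have m: "0 \<le> m" unfolding m_def by (rule m_form_nonneg[OF pos, of "e 0"]) (auto simp: e_in_D norm_e)
  have fn: "form_norm (F c d) x = sqrt (c * Q x + d * (cmod (\<phi> x))\<^sup>2 + (1 + m) * (norm x)\<^sup>2)"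
    if "x \<in> D" for x
    unfolding form_norm_def Re_F_self[OF that] m_def ..
  fix f :: "nat \<Rightarrow> 'a"
  assume "\<forall>n. f n \<in> fst (F c d)"
    and cauchy: "\<forall>r>0. \<exists>N. \<forall>i\<ge>N. \<forall>j\<ge>N. form_norm (F c d) (f i - f j) < r"
  then have f: "\<And>n. f n \<in> D" by auto
  \<comment> \<open>All summands under the root are nonnegative, so each is controlled separately;
    \<open>0 \<le> m\<close> makes the weight of the norm at least 1.\<close>
  have est: "\<exists>N. \<forall>i\<ge>N. \<forall>j\<ge>N. c * Q (f i - f j) < r\<^sup>2 \<and> norm (f i - f j) < r" if r: "0 < r" for r
  proof -
    obtain N where N: "\<And>i j. i \<ge> N \<Longrightarrow> j \<ge> N \<Longrightarrow> form_norm (F c d) (f i - f j) < r"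
      using cauchy r by blast
    have "c * Q (f i - f j) < r\<^sup>2 \<and> norm (f i - f j) < r" if "i \<ge> N" "j \<ge> N" for i j
    proof -
      let ?x = "f i - f j"
      have x: "?x \<in> D" by (intro D_diff f)
      have "c * Q ?x + d * (cmod (\<phi> ?x))\<^sup>2 + (1 + m) * (norm ?x)\<^sup>2 < r\<^sup>2"
        using N[OF that] r unfolding fn[OF x] by (metis less_le real_sqrt_less_iff real_sqrt_unique)
      moreover have "0 \<le> c * Q ?x" "0 \<le> d * (cmod (\<phi> ?x))\<^sup>2" "0 \<le> m * (norm ?x)\<^sup>2"
        using Q_nonneg[OF x] c d m by auto
      ultimately have "c * Q ?x < r\<^sup>2" "(norm ?x)\<^sup>2 < r\<^sup>2"
        using zero_le_power2[of "norm ?x"] by (simp_all only: distrib_right mult_1_left)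
      then show ?thesis using r by (auto intro: power_less_imp_less_base[of _ 2])
    qed
    then show ?thesis by blast
  qed
  have "Cauchy f"
    unfolding Cauchy_def dist_norm using est by meson
  then obtain x where x: "f \<longlonglongrightarrow> x" using Cauchy_convergent convergent_def by blast
  have Qlim: "x \<in> D \<and> (\<exists>N. \<forall>n\<ge>N. Q (x - f n) \<le> r)" if r: "0 < r" for r
  proof -
    obtain N where N: "\<And>i j. i \<ge> N \<Longrightarrow> j \<ge> N \<Longrightarrow> c * Q (f i - f j) < (sqrt (c * r))\<^sup>2"
      using est[of "sqrt (c * r)"] r c by auto
    have "Q (f i - f j) \<le> r" if "i \<ge> N" "j \<ge> N" for i j
      using N[OF that] r c by simp
    from Q_lim[OF f x f this] show ?thesis by blast
  qed
  have xD: "x \<in> D" using Qlim[of 1] by simp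
  have Q0: "(\<lambda>n. Q (f n - x)) \<longlonglongrightarrow> 0"
  proof (rule LIMSEQ_I)
    fix r :: real assume r: "0 < r"
    then obtain N where N: "\<And>n. n \<ge> N \<Longrightarrow> Q (x - f n) \<le> r / 2" using Qlim[of "r / 2"] by auto
    have "Q (f n - x) = Q (x - f n)" for n
      by (simp add: Q_def coef_diff norm_minus_commute)
    then have "norm (Q (f n - x) - 0) < r" if "n \<ge> N" for n
      using N[OF that] r Q_nonneg[OF D_diff[OF xD f], of n] by simp
    then show "\<exists>N. \<forall>n\<ge>N. norm (Q (f n - x) - 0) < r" by blast
  qed
  have p0: "(\<lambda>n. (cmod (\<phi> (f n - x)))\<^sup>2) \<longlonglongrightarrow> 0"
    by (rule tendsto_sandwich[OF _ _ tendsto_const, of _ _ _ "\<lambda>n. 2 * Q (f n - x)"])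
      (use \<phi>_bound[OF D_diff[OF f xD]] tendsto_mult_right_zero[OF Q0, of 2] in auto)
  have "(\<lambda>n. norm (f n - x)) \<longlonglongrightarrow> 0"
    using x by (simp add: LIM_zero_iff tendsto_norm_zero_iff)
  then have "(\<lambda>n. sqrt (c * Q (f n - x) + d * (cmod (\<phi> (f n - x)))\<^sup>2 + (1 + m) * (norm (f n - x))\<^sup>2))
      \<longlonglongrightarrow> sqrt (c * 0 + d * 0 + (1 + m) * 0\<^sup>2)"
    by (intro tendsto_intros Q0 p0)
  then have "(\<lambda>n. form_norm (F c d) (f n - x)) \<longlonglongrightarrow> 0"
    by (simp add: fn[OF D_diff[OF f xD]])
  then show "\<exists>x\<in>fst (F c d). (\<lambda>n. form_norm (F c d) (f n - x)) \<longlonglongrightarrow> 0"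
    using xD by auto
qed

text \<open>With \<open>c\<close> and \<open>c'\<close> positive, both summands and their sum are
  closed, hence equal to their regular parts, and the regularity condition becomes
  \<open>F_add\<close>.\<close>

lemma oplus_bar_F:
  assumes "0 < c" "0 \<le> d" "0 < c'" "0 \<le> d'"
  shows "oplus_bar (F c d) (F c' d') = Some (F (c + c') (d + d'))"
  using assms by (simp add: oplus_bar_def F_in_Vf oplus_defined_def F_add regular_part_closed closed_F)

section \<open>The regular part of the rank-one form\<close>

text \<open>The averages of \<open>e 0, \<dots>, e n\<close> tend to \<open>0\<close> while \<open>\<phi>\<close> is \<open>1\<close> on them. So each \<open>x \<in> D\<close>
  is a limit of vectors in the kernel of \<open>\<phi>\<close>, on which every form below \<open>F 0 1\<close> vanishes.\<close>

lemma closable_below_rank_one: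
  assumes u: "positive_form u" "closable_form u" and dom: "fst u = D"
    and le: "\<And>x. x \<in> D \<Longrightarrow> Re (snd u x x) \<le> (cmod (\<phi> x))\<^sup>2" and x: "x \<in> D"
  shows "Re (snd u x x) \<le> 0"
proof -
  obtain w where w: "closed_form w" and ext: "form_extends w u"
    using u(2) unfolding closable_form_def by blast
  have wp: "positive_form w" using w unfolding closed_form_def by blast
  have Dw: "D \<subseteq> fst w" and wu: "\<And>x. x \<in> D \<Longrightarrow> snd w x x = snd u x x"
    using ext dom unfolding form_extends_def by auto
  define m where "m = m_form w"
  have m: "0 \<le> m" unfolding m_def
    by (rule m_form_nonneg[OF wp, of "e 0"]) (use e_in_D Dw norm_e in auto)
  define v where "v n = comb (\<lambda>_. complex_of_real (1 / real (Suc n))) (Suc n)" for n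
  have vD: "v n \<in> D" for n by (simp add: v_def comb_in_D)
  have pv: "\<phi> (v n) = 1" for n
    by (simp add: v_def \<phi>_comb del: of_nat_Suc sum.lessThan_Suc)
  have nv: "(norm (v n))\<^sup>2 = 1 / real (Suc n)" for n
    unfolding v_def comb_def
    by (subst norm_sum_e) (simp_all add: norm_divide power2_eq_square del: of_nat_Suc sum.lessThan_Suc)
  have "(\<lambda>n. sqrt ((norm (v n))\<^sup>2)) \<longlonglongrightarrow> sqrt 0"
    unfolding nv by (intro tendsto_intros LIMSEQ_Suc[OF lim_1_over_n[where 'a=real]])
  then have v0: "(\<lambda>n. norm (v n)) \<longlonglongrightarrow> 0" by simp
  define f where "f n = x - \<phi> x *\<^sub>C v n" for n
  have fD: "f n \<in> D" for n unfolding f_def by (intro D_diff x D_scaleC vD)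
  have pf: "\<phi> (f n) = 0" for n by (simp add: f_def \<phi>_diff x D_scaleC vD \<phi>_scaleC pv)
  have "(\<lambda>n. cmod (\<phi> x) * norm (v n)) \<longlonglongrightarrow> 0" by (rule tendsto_mult_right_zero[OF v0])
  then have "(\<lambda>n. f n - x) \<longlonglongrightarrow> 0"
    by (subst tendsto_norm_zero_iff[symmetric]) (simp add: f_def norm_scaleC)
  then have fx: "f \<longlonglongrightarrow> x" by (rule LIM_zero_cancel)
  have ker: "Re (snd w y y) = 0" if "y \<in> D" "\<phi> y = 0" for y
    using le[OF that(1)] wu[OF that(1)] that positive_formD(9)[OF wp, of y] Dw by auto
  \<comment> \<open>The differences lie in the kernel of \<open>\<phi>\<close>, where
    \<open>w\<close> vanishes, so on them the form norm is a multiple of the norm.\<close>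
  have "\<forall>r>0. \<exists>N. \<forall>i\<ge>N. \<forall>j\<ge>N. form_norm w (f i - f j) < r"
  proof (intro allI impI)
    fix r :: real assume r: "0 < r"
    have "Cauchy f" using fx by (rule LIMSEQ_imp_Cauchy)
    then obtain N where N: "\<And>i j. i \<ge> N \<Longrightarrow> j \<ge> N \<Longrightarrow> norm (f i - f j) < r / sqrt (1 + m)"
      unfolding Cauchy_def dist_norm using r m by (metis add_pos_nonneg divide_pos_pos real_sqrt_gt_zero zero_less_one)
    have "form_norm w (f i - f j) = sqrt (1 + m) * norm (f i - f j)" for i j
      using ker[OF D_diff[OF fD fD], of i j]
      by (simp add: form_norm_def m_def \<phi>_diff fD pf real_sqrt_mult)
    then show "\<exists>N. \<forall>i\<ge>N. \<forall>j\<ge>N. form_norm w (f i - f j) < r"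
      using N m by (intro exI[of _ N]) (simp add: field_simps)
  qed
  then obtain y where y: "y \<in> fst w" and lim: "(\<lambda>n. form_norm w (f n - y)) \<longlonglongrightarrow> 0"
    using w fD Dw unfolding closed_form_def by (metis subsetD)
  have dw: "f n - y \<in> fst w" for n
    using csubspace_diff[OF positive_formD(1)[OF wp] _ y] fD Dw by blast
  have sq: "(form_norm w (f n - y))\<^sup>2 = Re (snd w (f n - y) (f n - y)) + (1 + m) * (norm (f n - y))\<^sup>2" for n
    using positive_formD(9)[OF wp dw] m by (simp add: form_norm_def m_def)
  have sq0: "(\<lambda>n. (form_norm w (f n - y))\<^sup>2) \<longlonglongrightarrow> 0"
    using tendsto_power[OF lim, of 2] by simp
  have nle: "norm (f n - y) \<le> form_norm w (f n - y)" for n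
  proof -
    have "0 \<le> m * (norm (f n - y))\<^sup>2" using m by simp
    then have "(norm (f n - y))\<^sup>2 \<le> (form_norm w (f n - y))\<^sup>2"
      unfolding sq using positive_formD(9)[OF wp dw[of n]] by (simp add: distrib_right)
    moreover have "0 \<le> form_norm w (f n - y)"
      using positive_formD(9)[OF wp dw] m by (simp add: form_norm_def m_def)
    ultimately show ?thesis by (rule power2_le_imp_le)
  qed
  \<comment> \<open>The form norm dominates the norm, so the limit supplied by closedness must be
    the norm limit \<open>x\<close>.\<close>
  have "(\<lambda>n. f n - y) \<longlonglongrightarrow> 0"
    by (rule Lim_null_comparison[OF _ lim]) (simp add: nle)
  then have "f \<longlonglongrightarrow> y" by (rule LIM_zero_cancel)
  with fx have yx: "y = x" using LIMSEQ_unique by blast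
  \<comment> \<open>Split \<open>x = (x - f n) + f n\<close>; the second part contributes nothing
    because \<open>w\<close> vanishes at \<open>f n\<close>.\<close>
  have bound: "Re (snd w x x) \<le> 2 * (form_norm w (f n - x))\<^sup>2" for n
  proof -
    have "x - f n \<in> fst w" using D_diff[OF x fD] Dw by blast
    from positive_form_add_le[OF wp this, of "f n"] fD Dw ker[OF fD pf]
    have "Re (snd w x x) \<le> 2 * Re (snd w (x - f n) (x - f n))" by auto
    also have "snd w (x - f n) (x - f n) = snd w (f n - x) (f n - x)"
    proof -
      have "x - f n = (- 1) *\<^sub>C (f n - x)" by (simp flip: minus_eq_scaleC)
      then show ?thesis using dw[of n] D_diff[OF x fD, of n] Dw
        by (auto simp: yx positive_formD(5,6)[OF wp])
    qed
    also have "2 * Re \<dots> \<le> 2 * (form_norm w (f n - x))\<^sup>2"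
      using m unfolding sq[unfolded yx] by simp
    finally show ?thesis .
  qed
  have "(\<lambda>n. 2 * (form_norm w (f n - x))\<^sup>2) \<longlonglongrightarrow> 2 * 0"
    using sq0 unfolding yx by (rule tendsto_mult_left)
  then have "Re (snd w x x) \<le> 2 * 0" by (rule LIMSEQ_le_const) (use bound in blast)
  then show ?thesis by (simp add: wu[OF x])
qed

text \<open>Provides the closed extension that makes \<open>F 0 0\<close> closable; the form norm
  here is a multiple of the norm.\<close>

lemma closed_zero_form: "closed_form (zero_form :: 'a form)"
  unfolding closed_form_def
proof (intro conjI allI impI)
  show pos: "positive_form (zero_form :: 'a form)"
    by (simp add: positive_form_def is_form_def zero_form_def csubspace_def)
  define m where "m = m_form (zero_form :: 'a form)"
  have m: "0 \<le> m" unfolding m_def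
    by (rule m_form_nonneg[OF pos, of "e 0"]) (auto simp: norm_e zero_form_def)
  have fn: "form_norm zero_form x = sqrt (1 + m) * norm x" for x :: 'a
    using m by (simp add: form_norm_def m_def zero_form_def real_sqrt_mult)
  fix f :: "nat \<Rightarrow> 'a"
  assume cauchy: "\<forall>r>0. \<exists>N. \<forall>i\<ge>N. \<forall>j\<ge>N. form_norm zero_form (f i - f j) < r"
  have "norm z \<le> form_norm zero_form z" for z :: 'a
    using mult_right_mono[of 1 "sqrt (1 + m)" "norm z"] m by (simp add: fn)
  then have "Cauchy f"
    unfolding Cauchy_def dist_norm using cauchy by (meson order_le_less_trans)
  then obtain x where "f \<longlonglongrightarrow> x" using Cauchy_convergent convergent_def by blast
  then have "(\<lambda>n. norm (f n - x)) \<longlonglongrightarrow> 0" by (simp add: LIM_zero_iff tendsto_norm_zero_iff)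
  then have "(\<lambda>n. form_norm zero_form (f n - x)) \<longlonglongrightarrow> 0"
    unfolding fn by (rule tendsto_mult_right_zero)
  then show "\<exists>x\<in>fst zero_form. (\<lambda>n. form_norm zero_form (f n - x)) \<longlonglongrightarrow> 0"
    by (auto simp: zero_form_def)
qed

lemma regular_part_rank_one: "regular_part (F 0 1) = F 0 0"
proof (rule regular_part_eqI)
  have "form_extends zero_form (F 0 0)"
    by (simp add: form_extends_def zero_form_def snd_F)
  then have "closable_form (F 0 0)" using closed_zero_form closable_form_def by blast
  then show "is_regular_part (F 0 1) (F 0 0)"
    unfolding is_regular_part_def
    using positive_F[of 0 0] closable_below_rank_one by (auto simp: Re_F_self)
qed

section \<open>The induced order and the missing infimum\<close>

text \<open>A complement \<open>c\<close> has diagonal \<open>|\<phi>|^2\<close> on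
  \<open>D\<close>, so it is unbounded. As \<open>F 1 0\<close> is unbounded too, definedness of the
  sum forces the domain \<open>D\<close>, hence \<open>c = F 0 1\<close>. Its regular part is zero,
  so the regularity condition would read \<open>F 1 1 = F 1 0\<close>.\<close>

lemma not_le_F: "\<not> gea_le Vf oplus_bar (F 1 0) (F 1 1)"
proof
  assume "gea_le Vf oplus_bar (F 1 0) (F 1 1)"
  then obtain c where c: "c \<in> Vf" and eq: "oplus_bar (F 1 0) c = Some (F 1 1)"
    unfolding gea_le_def by blast
  then have def: "oplus_defined (F 1 0) c" and add: "form_add (F 1 0) c = F 1 1"
    and reg: "regular_part (F 1 1) = form_add (regular_part (F 1 0)) (regular_part c)"
    unfolding oplus_bar_def by (metis option.distinct(1) option.inject)+
  have pc: "positive_form c" using c unfolding Vf_def by blast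
  have "D \<inter> fst c = D" using arg_cong[OF add, of fst] by (simp add: form_add_def)
  then have Dc: "D \<subseteq> fst c" by blast
  have cx: "Re (snd c x x) = 0 * Q x + 1 * (cmod (\<phi> x))\<^sup>2" if x: "x \<in> D" for x
  proof -
    have "snd (form_add (F 1 0) c) x x = snd (F 1 0) x x + snd c x x"
      using x Dc by (auto simp: form_add_def)
    then have "Re (snd (F 1 1) x x) = Re (snd (F 1 0) x x) + Re (snd c x x)"
      unfolding add by simp
    then show ?thesis by (simp add: Re_F_self[OF x])
  qed
  have "\<not> bounded_form c" by (rule not_bounded_on_D[OF Dc cx]) auto
  then have "fst c = D" using def not_bounded_F[of 1 0] unfolding oplus_defined_def by simp
  then have "c = F 0 1"
    by (intro positive_form_eqI) (auto simp: positive_F pc cx Re_F_self)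
  then have "F 1 1 = F 1 0"
    using reg by (simp add: regular_part_closed closed_F regular_part_rank_one F_add)
  \<comment> \<open>The test vector is \<open>e 0\<close>, written as a combination so that
    \<open>\<phi>_comb\<close> evaluates \<open>\<phi>\<close> to 1.\<close>
  then have "Re (snd (F 1 1) (comb (\<lambda>_. 1) 1) (comb (\<lambda>_. 1) 1))
      = Re (snd (F 1 0) (comb (\<lambda>_. 1) 1) (comb (\<lambda>_. 1) 1))" by simp
  then show False by (simp add: Re_F_self comb_in_D \<phi>_comb)
qed

lemma Vf_not_complete: "\<not> mono_dedekind_down_sigma_complete (Vf :: 'a form set) oplus_bar"
proof
  assume comp: "mono_dedekind_down_sigma_complete (Vf :: 'a form set) oplus_bar"
  \<comment> \<open>Strictly decreasing to 1 and always above it: every difference needed below then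
    has a positive \<open>S\<close> part, as \<open>oplus_bar_F\<close> demands.\<close>
  define a where "a n = 1 + 1 / real (Suc n)" for n
  define f where "f n = F (a n) (a n)" for n
  have a1: "1 < a n" and adec: "a (Suc n) < a n" for n
    by (auto simp: a_def field_simps)
  have leI: "gea_le Vf oplus_bar (F c d) (F c' d')" if "0 < c" "0 \<le> d" "c < c'" "d \<le> d'" for c d c' d'
    unfolding gea_le_def
    using oplus_bar_F[of c d "c' - c" "d' - d"] F_in_Vf[of "c' - c" "d' - d"] that
    by (intro bexI[of _ "F (c' - c) (d' - d)"]) auto
  \<comment> \<open>Only the consequences of the order for domains and diagonals are extracted,
    since nothing is known about \<open>t\<close> beyond its bounds.\<close>
  have leD: "\<exists>c. positive_form c \<and> fst t = fst s \<inter> fst c \<and>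
      (\<forall>x\<in>fst t. Re (snd s x x) \<le> Re (snd t x x))"
    if st: "gea_le Vf oplus_bar s t" for s t :: "'a form"
  proof -
    obtain c where c: "c \<in> Vf" and "oplus_bar s c = Some t"
      using st unfolding gea_le_def by blast
    then have t: "t = form_add s c" unfolding oplus_bar_def by (metis option.distinct(1) option.inject)
    have pc: "positive_form c" using c unfolding Vf_def by blast
    then show ?thesis using positive_formD(9)[OF pc] by (intro exI[of _ c]) (auto simp: t form_add_def)
  qed
  have "f n \<in> Vf" "gea_le Vf oplus_bar (f (Suc n)) (f n)" for n
    using a1[of n] a1[of "Suc n"] adec[of n] unfolding f_def by (auto intro!: F_in_Vf leI)
  with comp obtain t where tV: "t \<in> Vf" and tf: "\<And>n. gea_le Vf oplus_bar t (f n)"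
    and glb: "\<And>s. s \<in> Vf \<Longrightarrow> (\<And>n. gea_le Vf oplus_bar s (f n)) \<Longrightarrow> gea_le Vf oplus_bar s t"
    unfolding mono_dedekind_down_sigma_complete_def by metis
  have s1: "gea_le Vf oplus_bar (F 1 1) t" and s0: "gea_le Vf oplus_bar (F 1 0) t"
    using a1 less_imp_le[OF a1] less_trans[OF zero_less_one a1]
    by (auto intro!: glb F_in_Vf leI less_imp_le simp: f_def)
  \<comment> \<open>Domains shrink upwards in the order: \<open>F 1 1\<close> below \<open>t\<close>
    gives one inclusion, \<open>t\<close> below \<open>f 0\<close> the other.\<close>
  have dom: "fst t = D" using leD[OF s1] leD[OF tf[of 0]] by (auto simp: f_def)
  \<comment> \<open>The diagonal of \<open>t\<close> is squeezed between that of
    \<open>F 1 1\<close> and its multiples by \<open>a n\<close>, which tend to it.\<close>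
  have "t = F 1 1"
  proof (rule positive_form_eqI)
    show "positive_form t" using tV unfolding Vf_def by blast
    fix x assume "x \<in> fst (F 1 1)"
    then have x: "x \<in> D" by simp
    let ?q = "Q x + (cmod (\<phi> x))\<^sup>2"
    have "(\<lambda>n. a n * ?q) \<longlonglongrightarrow> (1 + 0) * ?q"
      unfolding a_def by (intro tendsto_intros LIMSEQ_Suc[OF lim_1_over_n[where 'a=real]])
    moreover have "Re (snd t x x) \<le> a n * ?q" for n
      using leD[OF tf[of n]] x by (auto simp: f_def Re_F_self distrib_left)
    ultimately have "Re (snd t x x) \<le> ?q"
      by (intro LIMSEQ_le_const[of "\<lambda>n. a n * ?q"]) auto
    moreover have "?q \<le> Re (snd t x x)"
      using leD[OF s1] x dom by (auto simp: Re_F_self)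
    ultimately show "Re (snd t x x) = Re (snd (F 1 1) x x)" by (simp add: Re_F_self x)
  qed (use dom in \<open>auto simp: positive_F\<close>)
  then show False using s0 not_le_F by simp
qed

end

theorem theorem5p8:
  assumes "\<not> finite_dimensional_H TYPE('a::chilbert)"
  shows "\<not> mono_dedekind_down_sigma_complete (Vf :: 'a form set) oplus_bar"
proof -
  obtain e :: "nat \<Rightarrow> 'a" where e: "\<forall>n. norm (e n) = 1 \<and> (\<forall>k<n. cinner (e n) (e k) = 0)"
    using exists_orthonormal_sequence[OF assms] by blast
  then interpret orthonormal_sequence e by unfold_locales auto
  show ?thesis by (rule Vf_not_complete)
qed

end
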